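(* Let $R$ be an integral domain (not a field) that is finitely stable and an LPI-domain, and assume every maximal ideal of $R$ is stable. Then $R$ has finite character.
   Context: Let $R$ be an integral domain with quotient field $K\neq R$. For a nonzero ideal $I$ of $R$, $E(I):=(I:I)=\{x\in K: xI\subseteq I\}$. An ideal $I$ is locally principal if $IR_M$ is principal for every maximal ideal $M$ of $R$; it is invertible if $I(R:I)=R$, where $(R:I)=\{x\in K: xI\subseteq R\}$. $R$ is an LPI-domain if every locally principal nonzero ideal of $R$ is invertible. A nonzero ideal $I$ is stable if it is invertible as an ideal of the ring $E(I)$; $R$ is finitely stable if every nonzero finitely generated ideal of $R$ is stable. $R$ has finite character if every nonzero element of $R$ lies in only finitely many maximal ideals of $R$. *)

theory Defs
  imports Main
begin

text \<open>An integral domain R is represented as a subring of a field type 'a whose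
  fraction field is all of 'a (every element is a quotient of elements of R).
  Ideals, fractional ideals and overrings are subsets of 'a.\<close>

definition domain_in :: "'a::field set \<Rightarrow> bool" where
  "domain_in R \<longleftrightarrow> 0 \<in> R \<and> 1 \<in> R \<and>
     (\<forall>x\<in>R. \<forall>y\<in>R. x + y \<in> R \<and> x - y \<in> R \<and> x * y \<in> R)"

definition quotient_field_is_univ :: "'a::field set \<Rightarrow> bool" where
  "quotient_field_is_univ R \<longleftrightarrow> (\<forall>x. \<exists>a\<in>R. \<exists>b\<in>R. b \<noteq> 0 \<and> x = a / b)"

definition ideal_in :: "'a::field set \<Rightarrow> 'a set \<Rightarrow> bool" where
  "ideal_in I R \<longleftrightarrow> I \<subseteq> R \<and> 0 \<in> I \<and> (\<forall>x\<in>I. \<forall>y\<in>I. x + y \<in> I) \<and>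
     (\<forall>r\<in>R. \<forall>x\<in>I. r * x \<in> I)"

definition maximal_ideal_in :: "'a::field set \<Rightarrow> 'a set \<Rightarrow> bool" where
  "maximal_ideal_in M R \<longleftrightarrow> ideal_in M R \<and> M \<noteq> R \<and>
     (\<forall>J. ideal_in J R \<and> M \<subseteq> J \<longrightarrow> J = M \<or> J = R)"

definition setmult :: "'a::field set \<Rightarrow> 'a set \<Rightarrow> 'a set" where
  "setmult A B = {(\<Sum>i<n. f i * g i) | (n::nat) f g. \<forall>i<n. f i \<in> A \<and> g i \<in> B}"

definition colon :: "'a::field set \<Rightarrow> 'a set \<Rightarrow> 'a set" where
  "colon A B = {x. \<forall>b\<in>B. x * b \<in> A}"

definition endo :: "'a::field set \<Rightarrow> 'a set" where
  "endo I = colon I I"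

definition localization :: "'a::field set \<Rightarrow> 'a set \<Rightarrow> 'a set" where
  "localization R M = {a / s | a s. a \<in> R \<and> s \<in> R \<and> s \<notin> M}"

definition principal_in :: "'a::field set \<Rightarrow> 'a set \<Rightarrow> bool" where
  "principal_in J S \<longleftrightarrow> (\<exists>a. J = (\<lambda>x. a * x) ` S)"

definition invertible_in :: "'a::field set \<Rightarrow> 'a set \<Rightarrow> bool" where
  "invertible_in I S \<longleftrightarrow> setmult I (colon S I) = S"

definition locally_principal :: "'a::field set \<Rightarrow> 'a set \<Rightarrow> bool" where
  "locally_principal I R \<longleftrightarrow>
     (\<forall>M. maximal_ideal_in M R \<longrightarrow> principal_in (setmult I (localization R M)) (localization R M))"

definition LPI_domain :: "'a::field set \<Rightarrow> bool" where
  "LPI_domain R \<longleftrightarrow>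
     (\<forall>I. ideal_in I R \<and> I \<noteq> {0} \<and> locally_principal I R \<longrightarrow> invertible_in I R)"

definition stable_ideal :: "'a::field set \<Rightarrow> bool" where
  "stable_ideal I \<longleftrightarrow> invertible_in I (endo I)"

definition fin_gen_ideal :: "'a::field set \<Rightarrow> 'a set \<Rightarrow> bool" where
  "fin_gen_ideal I R \<longleftrightarrow> (\<exists>F. finite F \<and> F \<subseteq> R \<and>
      I = {(\<Sum>f\<in>F. r f * f) | r. \<forall>f\<in>F. r f \<in> R})"

definition finitely_stable :: "'a::field set \<Rightarrow> bool" where
  "finitely_stable R \<longleftrightarrow>
     (\<forall>I. ideal_in I R \<and> I \<noteq> {0} \<and> fin_gen_ideal I R \<longrightarrow> stable_ideal I)"

definition finite_character :: "'a::field set \<Rightarrow> bool" where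
  "finite_character R \<longleftrightarrow>
     (\<forall>x\<in>R. x \<noteq> 0 \<longrightarrow> finite {M. maximal_ideal_in M R \<and> x \<in> M})"

end

theory Submission
  imports Defs
begin

text \<open>Suppose that the nonzero element x lies in infinitely many maximal ideals M. Put
  E = E(M) and B = (E : M). For y in E, stability of the finitely generated ideal
  m(R + Ry), with m a nonzero element of M, gives a polynomial relation of degree at most 3
  for y over R that does not vanish modulo M. Hence E/M is zero-dimensional and has enough
  idempotents to compress a relation 1 = f_1 b_1 + ... + f_n b_n, with f_i in M and b_i in B, into
  a single congruence f b = 1 modulo M. It follows that M^2 lies in f R_M, so the contraction
  I_M of f R_M to R is locally principal, hence invertible, and M is the only maximal ideal
  containing it.

  All the ideals I_M contain z = x^2. The ideal J generated by the z (R : I_M) is locally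
  principal, because I_M becomes trivial at every maximal ideal except M. So J is invertible,
  hence finitely generated, and for M outside a finite set this forces (R : I_M) into R_M,
  which contradicts the invertibility of I_M.\<close>

subsection \<open>Subrings, ideals and sums of products\<close>

lemma setmult_mem:
  assumes "a \<in> A" "b \<in> B"
  shows "a * b \<in> setmult A B"
  unfolding setmult_def using assms
  by (intro CollectI exI[of _ "1::nat"] exI[of _ "\<lambda>_. a"] exI[of _ "\<lambda>_. b"]) simp

text \<open>Serves as the induction principle for \<open>setmult\<close>: T is taken to be the set
  of elements with the property wanted, which leaves only single products and closure under addition
  to check.\<close>

lemma setmult_subset:
  assumes "0 \<in> T" "\<And>x y. x \<in> T \<Longrightarrow> y \<in> T \<Longrightarrow> x + y \<in> T"
    and "\<And>a b. a \<in> A \<Longrightarrow> b \<in> B \<Longrightarrow> a * b \<in> T"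
  shows "setmult A B \<subseteq> T"
proof
  fix x assume "x \<in> setmult A B"
  then obtain n :: nat and f g
    where x: "x = (\<Sum>i<n. f i * g i)" and fg: "\<forall>i<n. f i \<in> A \<and> g i \<in> B"
    unfolding setmult_def by blast
  have "(\<Sum>i<m. f i * g i) \<in> T" if "m \<le> n" for m
    using that by (induction m) (auto simp: assms fg)
  then show "x \<in> T" unfolding x by blast
qed

lemma setmult_zero: "0 \<in> setmult A B"
  unfolding setmult_def by (intro CollectI exI[of _ "0::nat"]) simp

lemma setmult_add:
  assumes "x \<in> setmult A B" "y \<in> setmult A B"
  shows "x + y \<in> setmult A B"
proof -
  obtain n :: nat and f g
    where x: "x = (\<Sum>i<n. f i * g i)" and fg: "\<forall>i<n. f i \<in> A \<and> g i \<in> B"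
    using assms(1) unfolding setmult_def by blast
  have "(\<Sum>i<m. f i * g i) + y \<in> setmult A B" if "m \<le> n" for m
    using that
  proof (induction m)
    case 0
    then show ?case using assms(2) by simp
  next
    case (Suc m)
    then obtain k :: nat and f' g'
      where k: "(\<Sum>i<m. f i * g i) + y = (\<Sum>i<k. f' i * g' i)"
        and fg': "\<forall>i<k. f' i \<in> A \<and> g' i \<in> B"
      unfolding setmult_def by (auto simp: less_Suc_eq_le)
    have "(\<Sum>i<Suc m. f i * g i) + y =
        (\<Sum>i<Suc k. (f'(k := f m)) i * (g'(k := g m)) i)"
      using k by (simp add: algebra_simps)
    moreover have "\<forall>i<Suc k. (f'(k := f m)) i \<in> A \<and> (g'(k := g m)) i \<in> B"
      using fg fg' Suc.prems by auto
    ultimately show ?case unfolding setmult_def by blast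
  qed
  then show ?thesis unfolding x by blast
qed

locale subring_of_field =
  fixes R :: "'a::field set"
  assumes dom: "domain_in R"
begin

lemma closed [simp]:
  "0 \<in> R" "1 \<in> R"
  "x \<in> R \<Longrightarrow> y \<in> R \<Longrightarrow> x + y \<in> R"
  "x \<in> R \<Longrightarrow> y \<in> R \<Longrightarrow> x - y \<in> R"
  "x \<in> R \<Longrightarrow> y \<in> R \<Longrightarrow> x * y \<in> R"
  using dom unfolding domain_in_def by auto

lemma closed_uminus [simp]: "x \<in> R \<Longrightarrow> - x \<in> R"
  using closed(4)[of 0 x] by simp

lemma closed_power [simp]: "x \<in> R \<Longrightarrow> x ^ n \<in> R"
  by (induction n) auto

lemma closed_sum: "(\<And>i. i \<in> A \<Longrightarrow> f i \<in> R) \<Longrightarrow> sum f A \<in> R"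
  by (induction A rule: infinite_finite_induct) auto

lemma ideal_subset: "ideal_in I R \<Longrightarrow> x \<in> I \<Longrightarrow> x \<in> R"
  unfolding ideal_in_def by blast

lemma ideal_zero: "ideal_in I R \<Longrightarrow> 0 \<in> I"
  unfolding ideal_in_def by blast

lemma ideal_add: "ideal_in I R \<Longrightarrow> x \<in> I \<Longrightarrow> y \<in> I \<Longrightarrow> x + y \<in> I"
  unfolding ideal_in_def by blast

lemma ideal_mult_left: "ideal_in I R \<Longrightarrow> r \<in> R \<Longrightarrow> x \<in> I \<Longrightarrow> r * x \<in> I"
  unfolding ideal_in_def by blast

lemma ideal_mult_right: "ideal_in I R \<Longrightarrow> r \<in> R \<Longrightarrow> x \<in> I \<Longrightarrow> x * r \<in> I"
  using ideal_mult_left[of I r x] by (simp add: mult.commute)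

lemma ideal_uminus: "ideal_in I R \<Longrightarrow> x \<in> I \<Longrightarrow> - x \<in> I"
  using ideal_mult_left[of I "-1" x] by simp

lemma ideal_diff: "ideal_in I R \<Longrightarrow> x \<in> I \<Longrightarrow> y \<in> I \<Longrightarrow> x - y \<in> I"
  using ideal_add[of I x "- y"] ideal_uminus[of I y] by simp

lemma maximal_ideal: "maximal_ideal_in M R \<Longrightarrow> ideal_in M R"
  unfolding maximal_ideal_in_def by blast

lemma maximal_one: "maximal_ideal_in M R \<Longrightarrow> 1 \<notin> M"
  unfolding maximal_ideal_in_def ideal_in_def by (metis mult.right_neutral subsetI subset_antisym)

text \<open>The ideal M + tR properly contains M, so by maximality it contains 1. This is
  invertibility of t in the field R/M, phrased without forming the quotient.\<close>

lemma maximal_inverse: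
  assumes M: "maximal_ideal_in M R" and t: "t \<in> R" "t \<notin> M"
  obtains s where "s \<in> R" "1 - t * s \<in> M"
proof -
  note I = maximal_ideal[OF M]
  let ?J = "{m + t * s | m s. m \<in> M \<and> s \<in> R}"
  have "ideal_in ?J R"
    unfolding ideal_in_def
  proof (intro conjI ballI)
    show "?J \<subseteq> R" using t ideal_subset[OF I] by auto
    have "0 = 0 + t * 0" by simp
    then show "0 \<in> ?J" using ideal_zero[OF I] closed(1) by blast
  next
    fix x y assume "x \<in> ?J" "y \<in> ?J"
    then obtain m s m' s' where x: "x = m + t * s" "m \<in> M" "s \<in> R"
      and y: "y = m' + t * s'" "m' \<in> M" "s' \<in> R" by blast
    then have "x + y = (m + m') + t * (s + s')" by (simp add: algebra_simps)
    then show "x + y \<in> ?J" using x y ideal_add[OF I] closed(3) by blast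
  next
    fix r x assume r: "r \<in> R" and "x \<in> ?J"
    then obtain m s where x: "x = m + t * s" "m \<in> M" "s \<in> R" by blast
    then have "r * x = r * m + t * (r * s)" by (simp add: algebra_simps)
    then show "r * x \<in> ?J" using x r ideal_mult_left[OF I] closed(5) by blast
  qed
  moreover have "M \<subseteq> ?J"
  proof
    fix m assume "m \<in> M"
    moreover have "m = m + t * 0" by simp
    ultimately show "m \<in> ?J" using closed(1) by blast
  qed
  moreover have "?J \<noteq> M"
  proof -
    have "t = 0 + t * 1" by simp
    then have "t \<in> ?J" using ideal_zero[OF I] closed(2) by blast
    then show ?thesis using t by blast
  qed
  ultimately have "?J = R" using M unfolding maximal_ideal_in_def by blast
  then obtain m s where "1 = m + t * s" "m \<in> M" "s \<in> R" using closed(2) by blast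
  then have "1 - t * s = m" by (simp add: algebra_simps)
  with \<open>m \<in> M\<close> \<open>s \<in> R\<close> show ?thesis using that by metis
qed

lemma maximal_prime:
  assumes M: "maximal_ideal_in M R" and t: "t \<in> R" "t \<notin> M" and r: "r \<in> R" "t * r \<in> M"
  shows "r \<in> M"
proof -
  note I = maximal_ideal[OF M]
  obtain s where s: "s \<in> R" "1 - t * s \<in> M" using maximal_inverse[OF M t] .
  have "r = r * (1 - t * s) + s * (t * r)" by (simp add: algebra_simps)
  also have "\<dots> \<in> M" by (rule ideal_add[OF I ideal_mult_left[OF I r(1) s(2)] ideal_mult_left[OF I s(1) r(2)]])
  finally show ?thesis .
qed

lemma maximal_mult_notin:
  "maximal_ideal_in M R \<Longrightarrow> t \<in> R \<Longrightarrow> t \<notin> M \<Longrightarrow> r \<in> R \<Longrightarrow> r \<notin> M \<Longrightarrow> t * r \<notin> M"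
  using maximal_prime by blast

lemma maximal_not_subset:
  assumes "maximal_ideal_in M R" "maximal_ideal_in N R" "M \<noteq> N"
  obtains p where "p \<in> M" "p \<notin> N"
  using assms unfolding maximal_ideal_in_def by blast

lemma endo_subring:
  assumes "ideal_in I R"
  shows "domain_in (endo I)"
  using assms ideal_zero[OF assms] ideal_add[OF assms] ideal_diff[OF assms]
  unfolding domain_in_def endo_def colon_def
  by (auto simp: distrib_right left_diff_distrib mult.assoc)

lemma ideal_in_endo:
  assumes "ideal_in I R"
  shows "ideal_in I (endo I)"
  using assms unfolding ideal_in_def endo_def colon_def by (auto simp: subset_iff)

text \<open>Dividing t * j = a * r by t puts j into a R_N. Later local arguments can therefore be
  carried out in R with multipliers t outside N instead of fractions.\<close>

lemma principal_localization:
  assumes N: "maximal_ideal_in N R" and a: "a \<in> J"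
    and J: "\<And>j. j \<in> J \<Longrightarrow> \<exists>t\<in>R. t \<notin> N \<and> (\<exists>r\<in>R. t * j = a * r)"
  shows "principal_in (setmult J (localization R N)) (localization R N)"
proof -
  let ?L = "localization R N"
  have nz: "t \<noteq> 0" if "t \<notin> N" for t using that ideal_zero[OF maximal_ideal[OF N]] by blast
  have "setmult J ?L = (\<lambda>x. a * x) ` ?L"
  proof (rule subset_antisym)
    show "setmult J ?L \<subseteq> (\<lambda>x. a * x) ` ?L"
    proof (rule setmult_subset)
      have "(0::'a) = 0 / 1" by simp
      then have "0 \<in> ?L" unfolding localization_def using maximal_one[OF N] closed(1,2) by blast
      then show "0 \<in> (\<lambda>x. a * x) ` ?L" by force
    next
      fix x y assume "x \<in> (\<lambda>x. a * x) ` ?L" "y \<in> (\<lambda>x. a * x) ` ?L"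
      then obtain r s r' s' where x: "x = a * (r / s)" "r \<in> R" "s \<in> R" "s \<notin> N"
        and y: "y = a * (r' / s')" "r' \<in> R" "s' \<in> R" "s' \<notin> N"
        unfolding localization_def by blast
      have "x + y = a * ((r * s' + r' * s) / (s * s'))"
        using x y nz by (simp add: field_simps)
      moreover have "(r * s' + r' * s) / (s * s') \<in> ?L"
        unfolding localization_def using x y maximal_mult_notin[OF N, of s s'] by force
      ultimately show "x + y \<in> (\<lambda>x. a * x) ` ?L" by blast
    next
      fix j l assume j: "j \<in> J" and "l \<in> ?L"
      then obtain r s where l: "l = r / s" "r \<in> R" "s \<in> R" "s \<notin> N"
        unfolding localization_def by blast
      obtain t r' where t: "t \<in> R" "t \<notin> N" "r' \<in> R" "t * j = a * r'" using J[OF j] by blast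
      have "j = a * r' / t" using t nz by (simp add: field_simps)
      then have "j * l = a * ((r' * r) / (t * s))" using l by simp
      moreover have "(r' * r) / (t * s) \<in> ?L"
        unfolding localization_def using t l maximal_mult_notin[OF N, of t s] by force
      ultimately show "j * l \<in> (\<lambda>x. a * x) ` ?L" by blast
    qed
  next
    show "(\<lambda>x. a * x) ` ?L \<subseteq> setmult J ?L" using a by (auto intro: setmult_mem)
  qed
  then show ?thesis unfolding principal_in_def by blast
qed

end

subsection \<open>Compressing a relation modulo an ideal with zero-dimensional quotient\<close>

text \<open>The last assumption puts u^3 into u^4 E modulo M, so E/M is strongly pi-regular, that
  is, zero-dimensional. The uniform exponent 3 is the degree of the relations from which it is
  obtained later.\<close>

locale pi_regular_quotient = subring_of_field E for E :: "'a::field set" +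
  fixes M :: "'a set"
  assumes ideal: "ideal_in M E"
    and pi_regular: "u \<in> E \<Longrightarrow> \<exists>c\<in>E. u ^ 3 - u ^ 4 * c \<in> M"
begin

definition cong (infix "\<approx>" 50) where "x \<approx> y \<longleftrightarrow> x - y \<in> M"

lemma cong_refl [simp]: "x \<approx> x"
  unfolding cong_def using ideal_zero[OF ideal] by simp

lemma cong_sym: "x \<approx> y \<Longrightarrow> y \<approx> x"
  unfolding cong_def using ideal_uminus[OF ideal, of "x - y"] by simp

lemma cong_trans [trans]: "x \<approx> y \<Longrightarrow> y \<approx> z \<Longrightarrow> x \<approx> z"
  unfolding cong_def using ideal_add[OF ideal, of "x - y" "y - z"] by simp

lemma cong_add: "x \<approx> y \<Longrightarrow> x' \<approx> y' \<Longrightarrow> x + x' \<approx> y + y'"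
  unfolding cong_def using ideal_add[OF ideal, of "x - y" "x' - y'"] by (simp add: algebra_simps)

lemma cong_diff: "x \<approx> y \<Longrightarrow> x' \<approx> y' \<Longrightarrow> x - x' \<approx> y - y'"
  unfolding cong_def using ideal_diff[OF ideal, of "x - y" "x' - y'"] by (simp add: algebra_simps)

lemma cong_mult:
  assumes "x \<approx> y" "x' \<approx> y'" "x \<in> E" "y' \<in> E"
  shows "x * x' \<approx> y * y'"
proof -
  have "x * x' - y * y' = x * (x' - y') + y' * (x - y)" by (simp add: algebra_simps)
  also have "\<dots> \<in> M" using assms unfolding cong_def
    by (intro ideal_add[OF ideal] ideal_mult_left[OF ideal])
  finally show ?thesis unfolding cong_def .
qed

lemma cong_power:
  assumes "x \<approx> y" "x \<in> E" "y \<in> E"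
  shows "x ^ n \<approx> y ^ n"
  by (induction n) (auto intro!: cong_mult simp: assms)

lemma idempotent_power:
  assumes "e \<in> E" "e * e \<approx> e" "0 < n"
  shows "e ^ n \<approx> e"
  using assms(3)
proof (induction n rule: nat_induct_non_zero)
  case (Suc n)
  have "e ^ Suc n = e * e ^ n" by simp
  also have "\<dots> \<approx> e * e" using Suc assms by (intro cong_mult) auto
  also have "\<dots> \<approx> e" by fact
  finally show ?case .
qed simp

text \<open>A zero-dimensional quotient splits u into a unit part and a nilpotent part: u * d is the
  idempotent supporting the unit part, where d inverts u, and u^3 vanishes on the
  complement.\<close>

lemma exists_idempotent:
  assumes u: "u \<in> E"
  obtains d where "d \<in> E" "(u * d) * (u * d) \<approx> u * d" "u ^ 3 * (1 - u * d) \<approx> 0"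
proof -
  obtain c where c: "c \<in> E" and m: "u ^ 3 - u ^ 4 * c \<in> M" using pi_regular[OF u] by blast
  \<comment> \<open>With this choice u * d = (u * c)^3. The factor 1 - u * c of 1 - (u * c)^3 is
    annihilated by u^3 modulo M.\<close>
  define d where "d = u ^ 2 * c ^ 3"
  have d: "d \<in> E" unfolding d_def using u c by simp
  have "u ^ 3 * (1 - u * d) = (u ^ 3 - u ^ 4 * c) * (1 + u * c + u ^ 2 * c ^ 2)"
    unfolding d_def by (simp add: algebra_simps eval_nat_numeral)
  also have "\<dots> \<in> M" using u c by (intro ideal_mult_right[OF ideal _ m]) simp
  finally have k: "u ^ 3 * (1 - u * d) \<in> M" .
  have "u * d - (u * d) * (u * d) = c ^ 3 * (u ^ 3 * (1 - u * d))"
    unfolding d_def by (simp add: algebra_simps eval_nat_numeral)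
  also have "\<dots> \<in> M" using c by (intro ideal_mult_left[OF ideal _ k]) simp
  finally have "(u * d) * (u * d) \<approx> u * d" using cong_sym unfolding cong_def by blast
  with d k show ?thesis using that[of d] by (simp add: cong_def)
qed

text \<open>The induction splits off from e the idempotent e1 supported by the last term; on the
  complement e2 that term is nilpotent, so the cube of the whole sum is a multiple of the
  remaining terms there.\<close>

lemma compress_sum:
  fixes n :: nat
  assumes "e \<in> E" "e * e \<approx> e" "e \<approx> (\<Sum>i<n. f i * b i)"
    and "\<And>i. i < n \<Longrightarrow> f i \<in> M" "\<And>i. i < n \<Longrightarrow> b i \<in> colon E M"
  shows "\<exists>g\<in>M. \<exists>c\<in>colon E M. g * c \<approx> e"
  using assms
\<comment> \<open>Both \<open>e\<close> and \<open>b\<close> vary, because the induction hypothesis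
  is applied to the smaller idempotent \<open>e2\<close> with each \<open>b i\<close> replaced by
  \<open>t * b i\<close>.\<close>
proof (induction n arbitrary: e b)
  case 0
  have "0 * 0 \<approx> e" using 0 cong_sym by simp
  moreover have "0 \<in> colon E M" unfolding colon_def by simp
  ultimately show ?case using ideal_zero[OF ideal] by blast
next
  case (Suc n)
  have colon: "g * c \<in> E" if "g \<in> M" "c \<in> colon E M" for g c
  proof -
    have "c * g \<in> E" using that unfolding colon_def by blast
    then show ?thesis by (simp add: mult.commute)
  qed
  have colon_mult: "t * c \<in> colon E M" if "t \<in> E" "c \<in> colon E M" for t c
    using that unfolding colon_def by (simp add: mult.assoc)
  have colon_add: "c + c' \<in> colon E M" if "c \<in> colon E M" "c' \<in> colon E M" for c c'
    using that unfolding colon_def by (simp add: distrib_right)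
  note e = \<open>e \<in> E\<close> and ee = \<open>e * e \<approx> e\<close>
  define v where "v = f n * b n"
  define w where "w = (\<Sum>i<n. f i * b i)"
  have v: "v \<in> E" unfolding v_def using Suc.prems(4,5) by (intro colon) simp_all
  have w: "w \<in> E" unfolding w_def using Suc.prems(4,5) by (intro closed_sum colon) simp_all
  \<comment> \<open>The factor e places the idempotent \<open>e1\<close> below e: since u is a
    multiple of e, e * e1 is congruent to e1, as the last congruence needs.\<close>
  define u where "u = e * v"
  have u: "u \<in> E" unfolding u_def using e v by simp
  obtain d where d: "d \<in> E" and dd: "(u * d) * (u * d) \<approx> u * d"
    and nil: "u ^ 3 * (1 - u * d) \<approx> 0" using exists_idempotent[OF u] .
  define e1 where "e1 = u * d"
  have e1: "e1 \<in> E" and e1e1: "e1 * e1 \<approx> e1" unfolding e1_def using u d dd by auto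
  define e2 where "e2 = e * (1 - e1)"
  have e2: "e2 \<in> E" unfolding e2_def using e e1 by simp
  have compl: "(1 - e1) * (1 - e1) \<approx> 1 - e1"
  proof -
    have "(1 - e1) * (1 - e1) = 1 - e1 - (e1 - e1 * e1)" by (simp add: algebra_simps)
    also have "\<dots> \<approx> 1 - e1 - (e1 - e1)" by (intro cong_diff cong_refl e1e1)
    finally show ?thesis by simp
  qed
  have orth: "e1 * (1 - e1) \<approx> 0"
    using cong_diff[OF cong_refl[of e1] e1e1] by (simp add: algebra_simps)
  have e2e2: "e2 * e2 \<approx> e2"
  proof -
    have "e2 * e2 = (e * e) * ((1 - e1) * (1 - e1))" unfolding e2_def by (simp add: algebra_simps)
    also have "\<dots> \<approx> e * (1 - e1)" using e e1 by (intro cong_mult ee compl) auto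
    finally show ?thesis unfolding e2_def .
  qed
  have e1e2: "e1 * e2 \<approx> 0"
  proof -
    have "e1 * e2 = e * (e1 * (1 - e1))" unfolding e2_def by (simp add: algebra_simps)
    also have "\<dots> \<approx> e * 0" using e by (intro cong_mult orth) auto
    finally show ?thesis by simp
  qed
  \<comment> \<open>The quadratic factor is the cofactor of w in (v + w)^3 - v^3.\<close>
  define t where "t = e ^ 3 * ((v + w) ^ 2 + (v + w) * v + v ^ 2) * (1 - e1)"
  have t: "t \<in> E" unfolding t_def using e e1 v w by simp
  have evw: "e \<approx> v + w" using Suc.prems(3) unfolding v_def w_def by (simp add: add.commute)
  have "e2 \<approx> w * t"
  proof -
    \<comment> \<open>Six factors of e are split into two cubes: one becomes (v + w)^3, the other
      turns v^3 into u^3, which 1 - e1 annihilates. Only w * t is left.\<close>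
    have "e2 \<approx> e ^ 6 * (1 - e1)"
      unfolding e2_def using e e1 ee
      by (intro cong_mult cong_sym[OF idempotent_power]) auto
    also have "e ^ 6 * (1 - e1) = e ^ 3 * (e ^ 3 * (1 - e1))"
      by (simp add: eval_nat_numeral mult.assoc)
    also have "\<dots> \<approx> e ^ 3 * ((v + w) ^ 3 * (1 - e1))"
      using e e1 v w by (intro cong_mult cong_power cong_refl evw) auto
    also have "(v + w) ^ 3 = v ^ 3 + w * ((v + w) ^ 2 + (v + w) * v + v ^ 2)"
      by (simp add: algebra_simps eval_nat_numeral)
    also have "e ^ 3 * (\<dots> * (1 - e1)) = u ^ 3 * (1 - e1) + w * t"
      unfolding t_def u_def by (simp add: distrib_left distrib_right power_mult_distrib mult_ac)
    also have "\<dots> \<approx> 0 + w * t" using nil unfolding e1_def by (intro cong_add) auto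
    finally show ?thesis by simp
  qed
  also have "w * t = (\<Sum>i<n. f i * (t * b i))"
    unfolding w_def sum_distrib_right by (simp add: mult_ac)
  finally obtain g c where g: "g \<in> M" and c: "c \<in> colon E M" and gc: "g * c \<approx> e2"
    using Suc.IH[of e2 "\<lambda>i. t * b i"] e2 e2e2 Suc.prems colon_mult[OF t] by auto
  \<comment> \<open>Two solutions are glued along orthogonal idempotents: on \<open>e1\<close> the
    factors \<open>f n\<close> and \<open>d * e * b n\<close> have product u * d = e1, and on
    \<open>e2\<close> the factors g and c have product e2. The cross terms, collected in
    \<open>h\<close> below, carry the factor e1 * e2, which is 0 modulo M.\<close>
  define g' where "g' = e1 * f n + e2 * g"
  define c' where "c' = (d * e * e1) * b n + e2 * c"
  have fn: "f n \<in> M" and bn: "b n \<in> colon E M" using Suc.prems by auto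
  have g': "g' \<in> M" unfolding g'_def using e1 e2 g fn
    by (intro ideal_add[OF ideal] ideal_mult_left[OF ideal])
  have c': "c' \<in> colon E M"
    unfolding c'_def using d e e1 e2 c bn by (intro colon_add colon_mult) auto
  define h where "h = f n * c + d * e * (g * b n)"
  have h: "h \<in> E" and gcE: "g * c \<in> E"
    unfolding h_def using colon fn bn g c d e by auto
  have "g' * c' = e1 * e1 * (u * d) + ((e2 * e2) * (g * c) + (e1 * e2) * h)"
    unfolding g'_def c'_def h_def u_def v_def by (simp add: algebra_simps)
  also have "\<dots> = e1 ^ 3 + ((e2 * e2) * (g * c) + (e1 * e2) * h)"
    unfolding e1_def by (simp add: eval_nat_numeral)
  also have "\<dots> \<approx> e1 + (e2 * e2 + 0 * h)"
    using e1 e2 h gcE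
    by (intro cong_add cong_mult idempotent_power e1e1 e2e2 e1e2 gc) auto
  also have "\<dots> = e1 + e2 * e2" by simp
  also have "\<dots> \<approx> e1 + e2" by (intro cong_add e2e2 cong_refl)
  also have "\<dots> = e + (e1 - e * e1)" unfolding e2_def by (simp add: algebra_simps)
  also have "\<dots> \<approx> e + (e1 - e1)"
  proof (intro cong_add cong_diff cong_refl)
    have "e * e1 = (e * e) * (v * d)" unfolding e1_def u_def by (simp add: algebra_simps)
    also have "\<dots> \<approx> e * (v * d)" using e v d by (intro cong_mult ee) auto
    finally show "e * e1 \<approx> e1" unfolding e1_def u_def by (simp add: mult.assoc)
  qed
  finally have "g' * c' \<approx> e" by simp
  with g' c' show ?case by blast
qed

end

subsection \<open>Stable maximal ideals\<close>

context subring_of_field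
begin

lemma two_generated_ideal:
  assumes "p \<in> R" "q \<in> R"
  defines "J \<equiv> {r * p + s * q | r s. r \<in> R \<and> s \<in> R}"
  shows "ideal_in J R" "fin_gen_ideal J R" "p \<in> J" "q \<in> J"
proof -
  show "ideal_in J R"
    unfolding ideal_in_def
  proof (intro conjI ballI)
    show "J \<subseteq> R" unfolding J_def using assms by auto
    have "0 = 0 * p + 0 * q" by simp
    then show "0 \<in> J" unfolding J_def using closed(1) by blast
  next
    fix x y assume "x \<in> J" "y \<in> J"
    then obtain r s r' s' where x: "x = r * p + s * q" "r \<in> R" "s \<in> R"
      and y: "y = r' * p + s' * q" "r' \<in> R" "s' \<in> R" unfolding J_def by blast
    then have "x + y = (r + r') * p + (s + s') * q" by (simp add: algebra_simps)
    then show "x + y \<in> J" unfolding J_def using x y closed(3) by blast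
  next
    fix t x assume t: "t \<in> R" and "x \<in> J"
    then obtain r s where x: "x = r * p + s * q" "r \<in> R" "s \<in> R" unfolding J_def by blast
    then have "t * x = (t * r) * p + (t * s) * q" by (simp add: algebra_simps)
    then show "t * x \<in> J" unfolding J_def using x t closed(5) by blast
  qed
  have "p = 1 * p + 0 * q" "q = 0 * p + 1 * q" by simp_all
  then show "p \<in> J" "q \<in> J" unfolding J_def using closed(1,2) by blast+
  have "J = {(\<Sum>f\<in>{p, q}. r f * f) | r. \<forall>f\<in>{p, q}. r f \<in> R}" (is "_ = ?S")
  proof (rule subset_antisym; rule subsetI)
    fix x assume "x \<in> J"
    then obtain r s where x: "x = r * p + s * q" "r \<in> R" "s \<in> R" unfolding J_def by blast
    \<comment> \<open>If p = q, the index set {p, q} has a single element, which must receive both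
      coefficients.\<close>
    define h where "h f = (if p = q then r + s else if f = p then r else s)" for f
    have "x = (\<Sum>f\<in>{p, q}. h f * f)" using x by (cases "p = q") (auto simp: h_def distrib_right)
    moreover have "\<forall>f\<in>{p, q}. h f \<in> R" using x by (auto simp: h_def)
    ultimately show "x \<in> ?S" by blast
  next
    fix x assume "x \<in> ?S"
    then obtain h where x: "x = (\<Sum>f\<in>{p, q}. h f * f)" "h p \<in> R" "h q \<in> R" by blast
    have "x = h p * p + (if p = q then 0 else h q) * q" using x by auto
    moreover have "(if p = q then 0 else h q) \<in> R" using x by simp
    ultimately show "x \<in> J" unfolding J_def using x by blast
  qed
  then show "fin_gen_ideal J R"
    unfolding fin_gen_ideal_def using assms by (intro exI[of _ "{p, q}"]) simp
qed

text \<open>The ideal J = m L of R is generated by m and m y, so it is stable: 1 = m h + m y k with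
  h, k in (E(J) : J). Then c = m h and d = m k. The memberships in L are equations for y over R of
  degree at most 3.\<close>

lemma stable_unit_decomposition:
  assumes fs: "finitely_stable R" and M: "ideal_in M R" and m: "m \<in> M" "m \<noteq> 0"
    and y: "y \<in> endo M"
  defines "L \<equiv> {r + s * y | r s. r \<in> R \<and> s \<in> R}"
  shows "\<exists>c\<in>L. \<exists>d\<in>L. 1 = c + d * y \<and> c * y ^ 2 \<in> L \<and> d * y ^ 2 \<in> L"
proof -
  define J where "J = {r * m + s * (m * y) | r s. r \<in> R \<and> s \<in> R}"
  have mR: "m \<in> R" and myR: "m * y \<in> R"
    using ideal_subset[OF M] m y unfolding endo_def colon_def by (auto simp: mult.commute)
  note J = two_generated_ideal[OF mR myR, folded J_def]
  have JL: "c \<in> L" if "c * m \<in> J" for c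
  proof -
    obtain r s where "c * m = r * m + s * (m * y)" "r \<in> R" "s \<in> R"
      using \<open>c * m \<in> J\<close> unfolding J_def by blast
    moreover from this have "c * m = (r + s * y) * m" by (simp add: algebra_simps)
    then have "c = r + s * y" using m by simp
    ultimately show ?thesis unfolding L_def by blast
  qed
  interpret EJ: subring_of_field "endo J"
    by unfold_locales (rule endo_subring[OF J(1)])
  let ?C = "colon (endo J) J"
  \<comment> \<open>J is generated over R by m and m * y, and \<open>?C\<close> absorbs coefficients
    from R, so every element of the product of J and \<open>?C\<close> has this two-term
    form.\<close>
  let ?T = "{m * h + m * y * k | h k. h \<in> ?C \<and> k \<in> ?C}"
  have C_add: "h + k \<in> ?C" if "h \<in> ?C" "k \<in> ?C" for h k
    using that unfolding colon_def by (auto simp: distrib_right)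
  have C_mult: "r * h \<in> ?C" if "r \<in> R" "h \<in> ?C" for r h
  proof -
    have "r \<in> endo J" using that(1) ideal_mult_left[OF J(1)] unfolding endo_def colon_def by blast
    then show ?thesis using that(2) unfolding colon_def[of "endo J"] by (auto simp: mult.assoc)
  qed
  have "J \<noteq> {0}" using J(3) m by blast
  then have "setmult J ?C = endo J"
    using fs J unfolding finitely_stable_def stable_ideal_def invertible_in_def by blast
  moreover have "setmult J ?C \<subseteq> ?T"
  proof (rule setmult_subset)
    have "0 \<in> ?C" unfolding colon_def by simp
    moreover have "0 = m * 0 + m * y * 0" by simp
    ultimately show "0 \<in> ?T" by blast
  next
    fix x x' assume "x \<in> ?T" "x' \<in> ?T"
    then obtain h k h' k' where x: "x = m * h + m * y * k" "h \<in> ?C" "k \<in> ?C"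
      and x': "x' = m * h' + m * y * k'" "h' \<in> ?C" "k' \<in> ?C" by blast
    then have "x + x' = m * (h + h') + m * y * (k + k')" by (simp add: algebra_simps)
    then show "x + x' \<in> ?T" using x x' C_add by blast
  next
    fix a b assume "a \<in> J" and b: "b \<in> ?C"
    then obtain r s where a: "a = r * m + s * (m * y)" "r \<in> R" "s \<in> R" unfolding J_def by blast
    then have "a * b = m * (r * b) + m * y * (s * b)" by (simp add: algebra_simps)
    then show "a * b \<in> ?T" using a b C_mult by blast
  qed
  ultimately have "1 \<in> ?T" using EJ.closed(2) by blast
  then obtain h k where hk: "1 = m * h + m * y * k" "h \<in> ?C" "k \<in> ?C" by blast
  \<comment> \<open>For g in (E(J) : J), g J J lies in J = m L. Applying this to the squares of m
    and m * y and cancelling m gives the two memberships.\<close>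
  have in_L: "m * g \<in> L \<and> m * g * y ^ 2 \<in> L" if "g \<in> ?C" for g
  proof -
    have "g * m \<in> endo J" "g * (m * y) \<in> endo J" using that J(3,4) unfolding colon_def by blast+
    then have "(g * m) * m \<in> J" "(g * (m * y)) * (m * y) \<in> J"
      using J(3,4) unfolding endo_def colon_def by blast+
    then have "(m * g) * m \<in> J" "(m * g * y ^ 2) * m \<in> J"
      by (simp_all add: power2_eq_square mult_ac)
    then show ?thesis by (blast intro: JL)
  qed
  show ?thesis
  proof (intro bexI conjI)
    show "1 = m * h + m * k * y" using hk(1) by (simp add: mult_ac)
  qed (use in_L hk in auto)
qed

text \<open>Let p_i be the first coefficient outside M and s its inverse modulo M. Multiplying the
  relation by s y^(3-i) turns the term of index i into y^3 modulo M, the lower terms fall into M,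
  and the higher ones are multiples of y^4. Shifting to degree 3 in every case makes the exponent
  independent of i.\<close>

lemma pi_regular_of_cubic:
  assumes M: "maximal_ideal_in M R" and y: "y \<in> endo M"
    and p: "p0 \<in> R" "p1 \<in> R" "p2 \<in> R" "p3 \<in> R"
    and rel: "p0 + p1 * y + p2 * y ^ 2 + p3 * y ^ 3 = 0"
    and nontrivial: "p0 \<notin> M \<or> p1 \<notin> M \<or> p2 \<notin> M \<or> p3 \<notin> M"
  shows "\<exists>c\<in>endo M. y ^ 3 - y ^ 4 * c \<in> M"
proof -
  note I = maximal_ideal[OF M]
  interpret E: subring_of_field "endo M"
    by unfold_locales (rule endo_subring[OF I])
  note IE = ideal_in_endo[OF I]
  have RE: "r \<in> endo M" if "r \<in> R" for r
    using that ideal_mult_left[OF I] unfolding endo_def colon_def by blast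
  note [simp] = y
  have y3: "y ^ 3 * k \<in> M" if "k \<in> M" for k
    by (rule E.ideal_mult_left[OF IE _ that]) simp
  note rules = E.ideal_add[OF IE] E.ideal_mult_left[OF IE]
  consider "p0 \<notin> M" | "p0 \<in> M" "p1 \<notin> M" | "p0 \<in> M" "p1 \<in> M" "p2 \<notin> M"
    | "p0 \<in> M" "p1 \<in> M" "p2 \<in> M" "p3 \<notin> M"
    using nontrivial by blast
  then show ?thesis
  proof cases
    case 1
    obtain s where s: "s \<in> R" "1 - p0 * s \<in> M" using maximal_inverse[OF M p(1) 1] .
    have "y ^ 3 - y ^ 4 * (- s * (p1 + p2 * y + p3 * y ^ 2)) = y ^ 3 * (1 - p0 * s)"
      using rel by algebra
    also have "\<dots> \<in> M" by (rule y3[OF s(2)])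
    finally show ?thesis by (rule bexI) (use s p RE in simp)
  next
    case 2
    obtain s where s: "s \<in> R" "1 - p1 * s \<in> M" using maximal_inverse[OF M p(2) 2(2)] .
    have "y ^ 3 - y ^ 4 * (- s * (p2 + p3 * y)) = y ^ 3 * (1 - p1 * s) - s * y ^ 2 * p0"
      using rel by algebra
    also have "\<dots> \<in> M" using s(1) 2 RE
      by (intro E.ideal_diff[OF IE y3[OF s(2)]] rules) simp_all
    finally show ?thesis by (rule bexI) (use s p RE in simp)
  next
    case 3
    obtain s where s: "s \<in> R" "1 - p2 * s \<in> M" using maximal_inverse[OF M p(3) 3(3)] .
    have "y ^ 3 - y ^ 4 * (- s * p3) = y ^ 3 * (1 - p2 * s) - (s * y * p0 + s * y ^ 2 * p1)"
      using rel by algebra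
    also have "\<dots> \<in> M" using s(1) 3 RE
      by (intro E.ideal_diff[OF IE y3[OF s(2)]] rules) simp_all
    finally show ?thesis by (rule bexI) (use s p RE in simp)
  next
    case 4
    obtain s where s: "s \<in> R" "1 - p3 * s \<in> M" using maximal_inverse[OF M p(4) 4(4)] .
    have "y ^ 3 - y ^ 4 * 0 = y ^ 3 * (1 - p3 * s) - (s * p0 + s * y * p1 + s * y ^ 2 * p2)"
      using rel by algebra
    also have "\<dots> \<in> M" using s(1) 4 RE
      by (intro E.ideal_diff[OF IE y3[OF s(2)]] rules) simp_all
    finally show ?thesis by (rule bexI) simp
  qed
qed

text \<open>Write c = a + b y and d = a' + b' y in the unit decomposition. That c y^2 and d y^2 lie
  in R + R y gives two cubic relations, with a, b and a', b' in degrees 2 and 3. These four cannot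
  all lie in M, since 1 = c + d y and M is an ideal of E(M).\<close>

lemma pi_regular_quotient_endo:
  assumes fs: "finitely_stable R" and M: "maximal_ideal_in M R" and m: "m \<in> M" "m \<noteq> 0"
  shows "pi_regular_quotient (endo M) M"
proof -
  note I = maximal_ideal[OF M]
  interpret E: subring_of_field "endo M"
    by unfold_locales (rule endo_subring[OF I])
  note IE = ideal_in_endo[OF I]
  show ?thesis
  proof unfold_locales
    show "ideal_in M (endo M)" by (rule IE)
  next
    fix y assume y: "y \<in> endo M"
    obtain c d where one': "1 = c + d * y"
      and c: "\<exists>r s. c = r + s * y \<and> r \<in> R \<and> s \<in> R"
        "\<exists>r s. c * y ^ 2 = r + s * y \<and> r \<in> R \<and> s \<in> R"
      and d: "\<exists>r s. d = r + s * y \<and> r \<in> R \<and> s \<in> R"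
        "\<exists>r s. d * y ^ 2 = r + s * y \<and> r \<in> R \<and> s \<in> R"
      using stable_unit_decomposition[OF fs I m y] by blast
    obtain a b p q where c': "c = a + b * y" "c * y ^ 2 = p + q * y"
      and "a \<in> R" "b \<in> R" "p \<in> R" "q \<in> R" using c by blast
    moreover obtain a' b' p' q' where d': "d = a' + b' * y" "d * y ^ 2 = p' + q' * y"
      and "a' \<in> R" "b' \<in> R" "p' \<in> R" "q' \<in> R" using d by blast
    ultimately have R: "a \<in> R" "b \<in> R" "a' \<in> R" "b' \<in> R"
      "p \<in> R" "q \<in> R" "p' \<in> R" "q' \<in> R" by blast+
    have one: "1 = (a + b * y) + (a' + b' * y) * y"
      and r1: "(a + b * y) * y ^ 2 = p + q * y" and r2: "(a' + b' * y) * y ^ 2 = p' + q' * y"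
      using one' c' d' by simp_all
    have "\<not> (a \<in> M \<and> b \<in> M \<and> a' \<in> M \<and> b' \<in> M)"
    proof
      assume "a \<in> M \<and> b \<in> M \<and> a' \<in> M \<and> b' \<in> M"
      then have "(a + b * y) + (a' + b' * y) * y \<in> M"
        by (intro E.ideal_add[OF IE] E.ideal_mult_right[OF IE] y) simp_all
      then have "1 \<in> M" using one by simp
      then show False using maximal_one[OF M] by blast
    qed
    then consider "a \<notin> M \<or> b \<notin> M" | "a' \<notin> M \<or> b' \<notin> M" by blast
    then show "\<exists>c\<in>endo M. y ^ 3 - y ^ 4 * c \<in> M"
    proof cases
      case 1
      have "- p + (- q) * y + a * y ^ 2 + b * y ^ 3 = 0" using r1 by algebra
      from pi_regular_of_cubic[OF M y _ _ _ _ this] show ?thesis using 1 R by simp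
    next
      case 2
      have "- p' + (- q') * y + a' * y ^ 2 + b' * y ^ 3 = 0" using r2 by algebra
      from pi_regular_of_cubic[OF M y _ _ _ _ this] show ?thesis using 2 R by simp
    qed
  qed
qed

text \<open>This is the inclusion of M^2 in f R_M, with one denominator s for all products.
  Stability of M writes 1 as a sum of products from M and (E(M) : M). Compression yields s = f c
  congruent to 1, and s p q = f (c p q) with c p q in E(M) M, hence in M.\<close>

lemma stable_maximal_local_generator:
  assumes fs: "finitely_stable R" and M: "maximal_ideal_in M R" and st: "stable_ideal M"
    and m: "m \<in> M" "m \<noteq> 0"
  shows "\<exists>f\<in>M. \<exists>s\<in>R. s \<notin> M \<and> (\<forall>p\<in>M. \<forall>q\<in>M. \<exists>r\<in>R. s * (p * q) = f * r)"
proof -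
  note I = maximal_ideal[OF M]
  interpret Q: pi_regular_quotient "endo M" M
    by (rule pi_regular_quotient_endo[OF fs M m])
  have "setmult M (colon (endo M) M) = endo M"
    using st unfolding stable_ideal_def invertible_in_def .
  then have "1 \<in> setmult M (colon (endo M) M)" by simp
  then obtain n :: nat and g b where "1 = (\<Sum>i<n. g i * b i)"
    and gb: "\<forall>i<n. g i \<in> M \<and> b i \<in> colon (endo M) M"
    unfolding setmult_def by blast
  then have "1 \<approx> (\<Sum>i<n. g i * b i)" by simp
  have "\<exists>f\<in>M. \<exists>c\<in>colon (endo M) M. f * c \<approx> 1"
    by (rule Q.compress_sum[OF _ _ \<open>1 \<approx> _\<close>]) (simp_all add: gb)
  then obtain f c
    where f: "f \<in> M" and c: "c \<in> colon (endo M) M" and fc: "f * c \<approx> 1" by blast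
  define s where "s = f * c"
  have s1: "s - 1 \<in> M" using fc unfolding Q.cong_def s_def .
  \<comment> \<open>A priori s lies only in E(M); being congruent to 1 modulo M, a subset of R, it
    lies in R.\<close>
  have sR: "s \<in> R"
    using closed(3)[OF ideal_subset[OF I s1] closed(2)] by simp
  have "s \<notin> M"
  proof
    assume "s \<in> M"
    from ideal_diff[OF I this s1] show False using maximal_one[OF M] by simp
  qed
  moreover have "\<exists>r\<in>R. s * (p * q) = f * r" if p: "p \<in> M" and q: "q \<in> M" for p q
  proof
    have "c * p \<in> endo M" using c p unfolding colon_def by blast
    then have "c * p * q \<in> M" using q unfolding endo_def colon_def by blast
    then show "c * p * q \<in> R" by (rule ideal_subset[OF I])
    show "s * (p * q) = f * (c * p * q)" unfolding s_def by (simp add: mult_ac)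
  qed
  ultimately show ?thesis using f sR by blast
qed

text \<open>The contraction of f R_M to R is generated by f at M. At any other maximal ideal it is
  trivial because it contains M^2. So it is locally principal, and the LPI property applies.\<close>

lemma invertible_between_square_and_maximal:
  assumes fs: "finitely_stable R" and lpi: "LPI_domain R"
    and M: "maximal_ideal_in M R" and st: "stable_ideal M" and m: "m \<in> M" "m \<noteq> 0"
  shows "\<exists>I. ideal_in I R \<and> invertible_in I R \<and> I \<subseteq> M \<and> (\<forall>p\<in>M. \<forall>q\<in>M. p * q \<in> I)"
proof -
  note iM = maximal_ideal[OF M]
  obtain f s where f: "f \<in> M" and s: "s \<in> R" "s \<notin> M"
    and sq: "\<And>p q. p \<in> M \<Longrightarrow> q \<in> M \<Longrightarrow> \<exists>r\<in>R. s * (p * q) = f * r"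
    using stable_maximal_local_generator[OF fs M st m] by blast
  define I where "I = {r \<in> R. \<exists>t\<in>R. t \<notin> M \<and> (\<exists>k\<in>R. t * r = f * k)}"
  have fR: "f \<in> R" by (rule ideal_subset[OF iM f])
  have I: "ideal_in I R"
    unfolding ideal_in_def
  proof (intro conjI ballI)
    show "I \<subseteq> R" unfolding I_def by blast
    have "s * 0 = f * 0" by simp
    then show "0 \<in> I" unfolding I_def using s(1,2) closed(1) by blast
  next
    fix x y assume "x \<in> I" "y \<in> I"
    then obtain t k t' k' where x: "x \<in> R" "t \<in> R" "t \<notin> M" "k \<in> R" "t * x = f * k"
      and y: "y \<in> R" "t' \<in> R" "t' \<notin> M" "k' \<in> R" "t' * y = f * k'" unfolding I_def by blast
    have "(t * t') * (x + y) = f * (t' * k + t * k')" using x(5) y(5) by algebra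
    moreover have "t * t' \<notin> M" using maximal_mult_notin[OF M] x y by blast
    ultimately show "x + y \<in> I" unfolding I_def using x y closed(3,5) by blast
  next
    fix r x assume r: "r \<in> R" and "x \<in> I"
    then obtain t k where x: "x \<in> R" "t \<in> R" "t \<notin> M" "k \<in> R" "t * x = f * k"
      unfolding I_def by blast
    then have "t * (r * x) = f * (r * k)" by algebra
    then show "r * x \<in> I" unfolding I_def using x r closed(5) by blast
  qed
  have "1 * f = f * 1" by simp
  then have fI: "f \<in> I" unfolding I_def using fR maximal_one[OF M] closed(2) by blast
  have IM: "I \<subseteq> M"
  proof
    fix x assume "x \<in> I"
    then obtain t k where x: "x \<in> R" "t \<in> R" "t \<notin> M" "k \<in> R" "t * x = f * k"
      unfolding I_def by blast
    then have "t * x \<in> M" using ideal_mult_right[OF iM _ f] by simp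
    then show "x \<in> M" using maximal_prime[OF M] x by blast
  qed
  have sqI: "p * q \<in> I" if "p \<in> M" "q \<in> M" for p q
  proof -
    have "p * q \<in> R" using ideal_subset[OF iM] that by simp
    then show ?thesis unfolding I_def using sq[OF that] s by blast
  qed
  have "m * m \<in> I" "m * m \<noteq> 0" using sqI m by auto
  then have "I \<noteq> {0}" by blast
  moreover have "locally_principal I R"
    unfolding locally_principal_def
  proof (intro allI impI)
    fix N assume N: "maximal_ideal_in N R"
    show "principal_in (setmult I (localization R N)) (localization R N)"
    proof (cases "N = M")
      case True
      show ?thesis
        unfolding True by (rule principal_localization[OF M fI]) (simp add: I_def)
    next
      case False
      then obtain p where p: "p \<in> M" "p \<notin> N" using maximal_not_subset[OF M N] by metis
      have "p * p \<in> R" "p * p \<notin> N"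
        using maximal_mult_notin[OF N] p ideal_subset[OF iM] by auto
      \<comment> \<open>The witnesses are t = p * p and r = j: an element of I outside N generates I
        R_N.\<close>
      then have "\<exists>t\<in>R. t \<notin> N \<and> (\<exists>r\<in>R. t * j = (p * p) * r)" if "j \<in> I" for j
        using ideal_subset[OF I that] by blast
      then show ?thesis by (rule principal_localization[OF N sqI[OF p(1) p(1)]])
    qed
  qed
  ultimately have "invertible_in I R" using lpi I unfolding LPI_domain_def by blast
  with I IM sqI show ?thesis by blast
qed

subsection \<open>Finite character\<close>

text \<open>Any t in I outside N is a common denominator for (R : I), which therefore lies in
  R_N.\<close>

lemma inverse_trivial_locally:
  assumes I: "ideal_in I R" and "\<not> I \<subseteq> N" and b: "b \<in> colon R I"
  shows "\<exists>t\<in>R. t \<notin> N \<and> t * b \<in> R"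
proof -
  obtain t where "t \<in> I" "t \<notin> N" using assms by blast
  then show ?thesis using b ideal_subset[OF I] unfolding colon_def by (auto simp: mult.commute)
qed

text \<open>The product of I and (R : I) is not inside N, so some s = i * a lies outside N. Then s *
  b = a * (b * i) with b * i in R, so a generates (R : I) at N.\<close>

lemma invertible_inverse_locally_principal:
  assumes I: "ideal_in I R" "invertible_in I R" and N: "maximal_ideal_in N R"
  shows "\<exists>a\<in>colon R I. \<exists>s\<in>R. s \<notin> N \<and> (\<forall>b\<in>colon R I. \<exists>r\<in>R. s * b = a * r)"
proof -
  have "\<exists>i\<in>I. \<exists>a\<in>colon R I. i * a \<notin> N"
  proof (rule ccontr)
    assume "\<not> ?thesis"
    then have "setmult I (colon R I) \<subseteq> N"
      using ideal_zero[OF maximal_ideal[OF N]] ideal_add[OF maximal_ideal[OF N]]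
      by (intro setmult_subset) auto
    then have "1 \<in> N" using I(2) unfolding invertible_in_def by auto
    then show False using maximal_one[OF N] by blast
  qed
  then obtain i a where ia: "i \<in> I" "a \<in> colon R I" "i * a \<notin> N" by blast
  have R: "b * i \<in> R" if "b \<in> colon R I" for b using ia(1) that unfolding colon_def by blast
  have "i * a \<in> R" using R[OF ia(2)] by (simp add: mult.commute)
  moreover have "\<exists>r\<in>R. i * a * b = a * r" if "b \<in> colon R I" for b
    using R[OF that] by (intro bexI[of _ "b * i"]) (simp_all add: mult_ac)
  ultimately show ?thesis using ia by blast
qed

text \<open>At each maximal ideal at most one of the ideals (R : I M) is nontrivial, so z times
  their sum is locally principal and hence invertible. A relation expressing 1 by finitely many of
  its elements involves only finitely many M; any further N would have (R : I N) inside R_N,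
  although \<open>I N\<close> lies in N.\<close>

lemma LPI_finite_family:
  assumes lpi: "LPI_domain R" and z: "z \<noteq> 0"
    and max: "\<And>M. M \<in> \<M> \<Longrightarrow> maximal_ideal_in M R"
    and I: "\<And>M. M \<in> \<M> \<Longrightarrow> ideal_in (I M) R"
    and inv: "\<And>M. M \<in> \<M> \<Longrightarrow> invertible_in (I M) R"
    and sub: "\<And>M. M \<in> \<M> \<Longrightarrow> I M \<subseteq> M"
    and other: "\<And>M N. M \<in> \<M> \<Longrightarrow> maximal_ideal_in N R \<Longrightarrow> N \<noteq> M \<Longrightarrow> \<not> I M \<subseteq> N"
    and zI: "\<And>M. M \<in> \<M> \<Longrightarrow> z \<in> I M"
  shows "finite \<M>"
proof (rule ccontr)
  assume inf: "infinite \<M>"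
  then obtain M0 where M0: "M0 \<in> \<M>" by fastforce
  \<comment> \<open>U is only a union; \<open>setmult\<close> supplies the sums, so J is z times the
    sum of all (R : I M). It lies in R because z belongs to every \<open>I M\<close>.\<close>
  define U where "U = (\<Union>M\<in>\<M>. colon R (I M))"
  define J where "J = setmult {z} U"
  have one: "1 \<in> colon R (I M)" if "M \<in> \<M>" for M
    using ideal_subset[OF I[OF that]] unfolding colon_def by simp
  have zb: "z * b \<in> J" if "M \<in> \<M>" "b \<in> colon R (I M)" for M b
    unfolding J_def U_def using that by (intro setmult_mem) auto
  have zJ: "z \<in> J" using zb[OF M0 one[OF M0]] by simp
  have iJ: "ideal_in J R"
    unfolding ideal_in_def
  proof (intro conjI ballI)
    show "J \<subseteq> R" unfolding J_def
    proof (rule setmult_subset)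
      fix a b assume "a \<in> {z}" "b \<in> U"
      then show "a * b \<in> R" unfolding U_def colon_def using zI by (auto simp: mult.commute)
    qed auto
    show "0 \<in> J" unfolding J_def by (rule setmult_zero)
    show "x + y \<in> J" if "x \<in> J" "y \<in> J" for x y
      using that unfolding J_def by (rule setmult_add)
  next
    fix r x assume r: "r \<in> R" and x: "x \<in> J"
    have "J \<subseteq> {x. r * x \<in> J}"
      unfolding J_def
    proof (rule setmult_subset)
      fix a b assume "a \<in> {z}" "b \<in> U"
      then obtain M where M: "M \<in> \<M>" "b \<in> colon R (I M)" and a: "a = z" unfolding U_def by blast
      then have "r * b \<in> colon R (I M)" using r unfolding colon_def by (simp add: mult.assoc)
      from zb[OF M(1) this] show "a * b \<in> {x. r * x \<in> setmult {z} U}"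
        unfolding a J_def by (simp add: mult_ac)
    qed (auto simp: setmult_zero setmult_add distrib_left)
    then show "r * x \<in> J" using x by blast
  qed
  have "locally_principal J R"
    unfolding locally_principal_def
  proof (intro allI impI)
    fix N assume N: "maximal_ideal_in N R"
    \<comment> \<open>The local generator at N is z * a with a generating (R : I N) at N if N
      belongs to \<open>\<M>\<close>, and z itself otherwise.\<close>
    have "\<exists>a\<in>J. \<forall>M\<in>\<M>. \<forall>b\<in>colon R (I M). \<exists>t\<in>R. t \<notin> N \<and> (\<exists>r\<in>R. t * (z * b) = a * r)"
    proof (cases "N \<in> \<M>")
      case True
      obtain a s where a: "a \<in> colon R (I N)" and s: "s \<in> R" "s \<notin> N"
        and sa: "\<And>b. b \<in> colon R (I N) \<Longrightarrow> \<exists>r\<in>R. s * b = a * r"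
        using invertible_inverse_locally_principal[OF I[OF True] inv[OF True] N] by blast
      show ?thesis
      proof (rule bexI[of _ "z * a"], intro ballI)
        fix M b assume M: "M \<in> \<M>" and b: "b \<in> colon R (I M)"
        \<comment> \<open>An element b from another M is moved into (R : I N): some multiple t * b
          with t outside N lies in R, and R is contained in (R : I N).\<close>
        obtain t c where t: "t \<in> R" "t \<notin> N" "c \<in> colon R (I N)" "t * b = c"
        proof (cases "M = N")
          case True
          then show ?thesis using that[of 1 b] b maximal_one[OF N] by simp
        next
          case False
          then obtain t where "t \<in> R" "t \<notin> N" "t * b \<in> R"
            using inverse_trivial_locally[OF I[OF M] other[OF M N] b] by blast
          moreover have "t * b \<in> colon R (I N)" if "t * b \<in> R"
            using that ideal_subset[OF I[OF \<open>N \<in> \<M>\<close>]] unfolding colon_def by simp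
          ultimately show ?thesis using that by blast
        qed
        obtain r where r: "r \<in> R" "s * c = a * r" using sa[OF t(3)] by blast
        have "(s * t) * (z * b) = z * (s * (t * b))" by (simp add: mult_ac)
        also have "\<dots> = z * a * r" using t(4) r(2) by (simp add: mult_ac)
        finally have "(s * t) * (z * b) = z * a * r" .
        moreover have "s * t \<notin> N" using maximal_mult_notin[OF N] s t by blast
        ultimately show "\<exists>t\<in>R. t \<notin> N \<and> (\<exists>r\<in>R. t * (z * b) = z * a * r)"
          using s t r closed(5) by blast
      qed (rule zb[OF True a])
    next
      case False
      show ?thesis
      proof (rule bexI[of _ z], intro ballI)
        fix M b assume M: "M \<in> \<M>" and b: "b \<in> colon R (I M)"
        have "N \<noteq> M" using False M by blast
        then obtain t where t: "t \<in> R" "t \<notin> N" "t * b \<in> R"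
          using inverse_trivial_locally[OF I[OF M] other[OF M N] b] by blast
        have "t * (z * b) = z * (t * b)" by (simp add: mult_ac)
        with t show "\<exists>t\<in>R. t \<notin> N \<and> (\<exists>r\<in>R. t * (z * b) = z * r)" by blast
      qed (rule zJ)
    qed
    then obtain a where a: "a \<in> J"
      and gen: "\<And>M b. M \<in> \<M> \<Longrightarrow> b \<in> colon R (I M) \<Longrightarrow>
        \<exists>t\<in>R. t \<notin> N \<and> (\<exists>r\<in>R. t * (z * b) = a * r)" by blast
    have "J \<subseteq> {j. \<exists>t\<in>R. t \<notin> N \<and> (\<exists>r\<in>R. t * j = a * r)}" (is "_ \<subseteq> ?T")
      unfolding J_def
    proof (rule setmult_subset)
      have "1 * 0 = a * 0" by simp
      then show "0 \<in> ?T" using maximal_one[OF N] closed(1,2) by blast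
    next
      fix x y assume "x \<in> ?T" "y \<in> ?T"
      then obtain t r t' r' where x: "t \<in> R" "t \<notin> N" "r \<in> R" "t * x = a * r"
        and y: "t' \<in> R" "t' \<notin> N" "r' \<in> R" "t' * y = a * r'" by blast
      have "(t * t') * (x + y) = a * (t' * r + t * r')" using x(4) y(4) by algebra
      moreover have "t * t' \<notin> N" using maximal_mult_notin[OF N] x y by blast
      ultimately show "x + y \<in> ?T" using x y closed(3,5) by blast
    qed (use gen in \<open>auto simp: U_def\<close>)
    then show "principal_in (setmult J (localization R N)) (localization R N)"
      by (intro principal_localization[OF N a]) blast
  qed
  moreover have "J \<noteq> {0}" using zJ z by blast
  ultimately have "setmult J (colon R J) = R"
    using lpi iJ unfolding LPI_domain_def invertible_in_def by blast
  then have one_J: "1 \<in> setmult J (colon R J)" by simp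
  \<comment> \<open>\<open>?P N y\<close> says that y (R : I N) lies in R_N with one common
    denominator, and \<open>?T\<close> collects the y for which this holds for all but finitely many
    N in \<open>\<M>\<close>. The aim is to show that 1 lies in \<open>?T\<close>.\<close>
  let ?P = "\<lambda>N y. \<exists>t\<in>R. t \<notin> N \<and> (\<forall>b\<in>colon R (I N). t * y * b \<in> R)"
  let ?T = "{y. \<exists>F. finite F \<and> (\<forall>N\<in>\<M> - F. ?P N y)}"
  have T0: "0 \<in> ?T" using max maximal_one by (auto intro!: exI[of _ "{}"] bexI[of _ 1])
  have T_add: "x + y \<in> ?T" if "x \<in> ?T" "y \<in> ?T" for x y
  proof -
    obtain F where F: "finite F" "\<forall>N\<in>\<M> - F. ?P N x" using \<open>x \<in> ?T\<close> by blast
    obtain G where G: "finite G" "\<forall>N\<in>\<M> - G. ?P N y" using \<open>y \<in> ?T\<close> by blast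
    have "?P N (x + y)" if N: "N \<in> \<M> - (F \<union> G)" for N
    proof -
      obtain t where t: "t \<in> R" "t \<notin> N" "\<forall>b\<in>colon R (I N). t * x * b \<in> R" using F(2) N by blast
      obtain t' where t': "t' \<in> R" "t' \<notin> N" "\<forall>b\<in>colon R (I N). t' * y * b \<in> R"
        using G(2) N by blast
      have "t * t' * (x + y) * b = t' * (t * x * b) + t * (t' * y * b)" for b
        by (simp add: algebra_simps)
      then have "\<forall>b\<in>colon R (I N). t * t' * (x + y) * b \<in> R" using t t' by simp
      moreover have "t * t' \<notin> N" using maximal_mult_notin[OF max] N t t' by blast
      ultimately show ?thesis using t t' closed(5) by blast
    qed
    then show ?thesis using F(1) G(1) by (intro CollectI exI[of _ "F \<union> G"]) blast
  qed
  have "setmult J (colon R J) \<subseteq> ?T"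
  proof (rule setmult_subset[OF T0 T_add])
    fix j h assume j: "j \<in> J" and h: "h \<in> colon R J"
    have "J \<subseteq> {j. j * h \<in> ?T}"
      unfolding J_def
    proof (rule setmult_subset)
      fix a c assume "a \<in> {z}" "c \<in> U"
      then obtain M where M: "M \<in> \<M>" "c \<in> colon R (I M)" and a: "a = z" unfolding U_def by blast
      \<comment> \<open>The only exception is M itself: for N different from M, t clears c at N,
        while h maps z * b into R because z * b lies in J.\<close>
      have "?P N (z * c * h)" if N: "N \<in> \<M> - {M}" for N
      proof -
        obtain t where t: "t \<in> R" "t \<notin> N" "t * c \<in> R"
          using inverse_trivial_locally[OF I[OF M(1)] other[OF M(1) max] M(2)] N by blast
        have "t * (z * c * h) * b \<in> R" if b: "b \<in> colon R (I N)" for b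
        proof -
          have "h * (z * b) \<in> R" using h zb N b unfolding colon_def by blast
          then have "(t * c) * (h * (z * b)) \<in> R" using t by simp
          then show ?thesis by (simp add: mult_ac)
        qed
        with t show ?thesis by blast
      qed
      then show "a * c \<in> {j. j * h \<in> ?T}"
        unfolding a by (intro CollectI exI[of _ "{M}"]) blast
    qed (use T0 T_add in \<open>simp_all only: mem_Collect_eq mult_zero_left distrib_right\<close>)
    then show "j * h \<in> ?T" using j by blast
  qed
  then have "1 \<in> ?T" using one_J by blast
  then obtain F where F: "finite F" "\<forall>N\<in>\<M> - F. ?P N 1" by auto
  obtain N where N: "N \<in> \<M>" "N \<notin> F"
    using inf F(1) by (meson finite_subset subsetI)
  then obtain t where t: "t \<in> R" "t \<notin> N" and "\<forall>b\<in>colon R (I N). t * 1 * b \<in> R"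
    using F(2) by blast
  then have tb: "t * b \<in> R" if "b \<in> colon R (I N)" for b using that by simp
  \<comment> \<open>Since t (R : I N) lies in R, multiplying the product of \<open>I N\<close> and
    its inverse by t lands in \<open>I N\<close>. That product is R, so t lies in \<open>I N\<close>
    and hence in N, a contradiction.\<close>
  have "setmult (I N) (colon R (I N)) \<subseteq> {y. t * y \<in> I N}"
  proof (rule setmult_subset)
    fix i b assume i: "i \<in> I N" and b: "b \<in> colon R (I N)"
    have "i * (t * b) \<in> I N" using ideal_mult_right[OF I[OF N(1)] tb[OF b] i] .
    then show "i * b \<in> {y. t * y \<in> I N}" by (simp add: mult_ac)
  qed (auto simp: distrib_left ideal_zero[OF I[OF N(1)]] ideal_add[OF I[OF N(1)]])
  then have "t * 1 \<in> I N" using inv[OF N(1)] closed(2) unfolding invertible_in_def by blast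
  then show False using sub[OF N(1)] t by auto
qed

end

theorem theorem12:
  fixes R :: "'a::field set"
  assumes "domain_in R" and "quotient_field_is_univ R" and "R \<noteq> UNIV"
    and "finitely_stable R" and "LPI_domain R"
    and "\<forall>M. maximal_ideal_in M R \<longrightarrow> stable_ideal M"
  shows "finite_character R"
  unfolding finite_character_def
proof (intro ballI impI)
  interpret subring_of_field R
    by unfold_locales (rule assms(1))
  fix x assume x: "x \<in> R" "x \<noteq> 0"
  let ?M = "{M. maximal_ideal_in M R \<and> x \<in> M}"
  have "\<exists>I. ideal_in I R \<and> invertible_in I R \<and> I \<subseteq> M \<and> (\<forall>p\<in>M. \<forall>q\<in>M. p * q \<in> I)"
    if "M \<in> ?M" for M
    using invertible_between_square_and_maximal[OF assms(4,5)] assms(6) that x(2) by blast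
  then obtain I where I: "\<And>M. M \<in> ?M \<Longrightarrow> ideal_in (I M) R \<and> invertible_in (I M) R \<and>
      I M \<subseteq> M \<and> (\<forall>p\<in>M. \<forall>q\<in>M. p * q \<in> I M)"
    by metis
  \<comment> \<open>Each \<open>I M\<close> is only known to contain the products of two elements of
    M. Hence the common element is x * x, and p * p with p in M outside N shows that
    \<open>I M\<close> is not inside N.\<close>
  show "finite ?M"
  proof (rule LPI_finite_family[OF assms(5), of "x * x" _ I])
    fix M N assume M: "M \<in> ?M" and N: "maximal_ideal_in N R" and "N \<noteq> M"
    then obtain p where p: "p \<in> M" "p \<notin> N" using maximal_not_subset[of M N] by blast
    then have "p * p \<notin> N"
      using maximal_mult_notin[OF N] ideal_subset[OF maximal_ideal] M by blast
    then show "\<not> I M \<subseteq> N" using I[OF M] p by blast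
  qed (use I x in auto)
qed

end
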